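(* Let $X_1,X_2,\ldots$ be iid random variables with cdf $F$ that has a finite second moment and a non-zero mean $\mu$, and let the quantile function $F^{-1}$ be continuous at the point $p\in (0,1)$. Let $F_n$ be the empirical cdf and $\mu_n$ the arithmetic mean of $X_1,\dots,X_n$, and let $$\mathrm{LC}(p)=\frac{1}{\mu}\int_0^p F^{-1}(u)\,du,\qquad \mathrm{LC}_n(p)=\frac{1}{\mu_n}\int_0^p F_n^{-1}(u)\,du .$$ Then, as $n\to\infty$, $$\sqrt{n}\left(\mathrm{LC}_{n}(p) - \mathrm{LC}(p) \right) = -\frac{1}{\sqrt{n}} \sum_{i=1}^n Y_{i}(p) + o_{\mathbb{P}}(1),$$ where $$Y_{i}(p)= \frac{1}{\mu } \int_{-\infty }^{F^{-1}(p)} \big( \mathbf{1}\{X_i\le x\} -F(x)\big)\, dx +\frac{\mathrm{LC}(p)}{\mu } \big( X_i-\mu \big) .$$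
   Context: The quantile function of a cdf $F$ is $F^{-1}(u)=\inf\{x\in\mathbb{R}: F(x)\ge u\}$ for $u\in(0,1]$ and $F^{-1}(0)=\lim_{u\downarrow 0}F^{-1}(u)$. The empirical cdf is $F_n(x)=\frac1n\sum_{i=1}^n\mathbf{1}\{X_i\le x\}$, with quantile function $F_n^{-1}$ defined in the same way; $\mu_n=\frac1n\sum_{i=1}^nX_i$ (the event $\mu_n=0$ has probability tending to $0$, so the value assigned to $\mathrm{LC}_n(p)$ on it is immaterial). $o_{\mathbb{P}}(1)$ denotes a term converging to $0$ in probability as $n\to\infty$. *)

theory Defs
  imports "HOL-Probability.Probability"
begin

text \<open>Extended-real valued: for \<open>u = 0\<close> and \<open>u = 1\<close> the quantile of a cdf may be infinite.
  For \<open>0 < u < 1\<close> it is finite. Values for \<open>u\<close> outside \<open>[0,1]\<close> are irrelevant.\<close>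
definition quantile :: "(real \<Rightarrow> real) \<Rightarrow> real \<Rightarrow> ereal" where
  "quantile F u =
     (if u = 0 then Lim (at_right 0) (\<lambda>v. INF x\<in>{x. F x \<ge> v}. ereal x)
      else (INF x\<in>{x. F x \<ge> u}. ereal x))"

definition lorenz :: "real \<Rightarrow> (real \<Rightarrow> real) \<Rightarrow> real \<Rightarrow> real" where
  "lorenz m F p = 1 / m * (LBINT u:{0..p}. real_of_ereal (quantile F u))"

text \<open>Samples are indexed from 1; \<open>X 0\<close> is never used.\<close>
definition empirical_cdf :: "(nat \<Rightarrow> 'a \<Rightarrow> real) \<Rightarrow> nat \<Rightarrow> 'a \<Rightarrow> real \<Rightarrow> real" where
  "empirical_cdf X n \<omega> x = 1 / real n * (\<Sum>i=1..n. indicator {..x} (X i \<omega>))"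

definition sample_mean :: "(nat \<Rightarrow> 'a \<Rightarrow> real) \<Rightarrow> nat \<Rightarrow> 'a \<Rightarrow> real" where
  "sample_mean X n \<omega> = 1 / real n * (\<Sum>i=1..n. X i \<omega>)"

text \<open>If the sample mean vanishes, the empirical value is \<open>0\<close> by the convention \<open>1 / 0 = 0\<close>.\<close>
definition empirical_lorenz :: "(nat \<Rightarrow> 'a \<Rightarrow> real) \<Rightarrow> nat \<Rightarrow> real \<Rightarrow> 'a \<Rightarrow> real" where
  "empirical_lorenz X n p \<omega> = lorenz (sample_mean X n \<omega>) (empirical_cdf X n \<omega>) p"

definition lorenz_influence :: "real \<Rightarrow> (real \<Rightarrow> real) \<Rightarrow> real \<Rightarrow> real \<Rightarrow> real" where
  "lorenz_influence \<mu> F p y =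
     1 / \<mu> * (LBINT x:{..real_of_ereal (quantile F p)}. (indicator {..x} y - F x))
     + lorenz \<mu> F p / \<mu> * (y - \<mu>)"

text \<open>Measurability is part of the definition because \<^const>\<open>measure\<close> is \<open>0\<close> on
  non-measurable sets, which would make the limit condition vacuous.\<close>
definition converges_to_zero_in_prob :: "'a measure \<Rightarrow> (nat \<Rightarrow> 'a \<Rightarrow> real) \<Rightarrow> bool" where
  "converges_to_zero_in_prob M R \<longleftrightarrow>
     (\<forall>n. R n \<in> borel_measurable M) \<and>
     (\<forall>\<epsilon>>0. (\<lambda>n. measure M {\<omega> \<in> space M. \<bar>R n \<omega>\<bar> > \<epsilon>}) \<longlonglongrightarrow> 0)"

end

theory Submission
  imports Defs
begin

text \<open>
  Exchanging integrals gives \<open>\<integral>\<^sub>0\<^sup>p G\<^sup>-\<^sup>1(u) du = p t - \<integral>\<^bsub>x \<le> t\<^esub> G(x) dx\<close> at \<open>t = G\<^sup>-\<^sup>1(p)\<close>, and the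
  right-hand side is maximal there as a function of \<open>t\<close>. Using the population quantile \<open>q\<close> in place of
  the empirical one therefore costs only a second-order remainder, bounded by
  \<open>\<integral> \<bar>F\<^sub>n - F\<bar>\<close> over a \<open>\<delta>\<close>-neighbourhood of \<open>q\<close> as soon as the empirical quantile lies in it; that
  happens with probability tending to \<open>1\<close> since \<open>F\<^sup>-\<^sup>1\<close> is continuous at \<open>p\<close>. As
  \<open>E \<bar>F\<^sub>n(x) - F(x)\<bar> \<le> 1 / \<surd>n\<close>, that bound times \<open>\<surd>n\<close> has mean at most \<open>2 \<delta>\<close>, with \<open>\<delta>\<close>
  arbitrary. What is left is a smooth function of two sample means, of \<open>max 0 (q - X)\<close> and of \<open>X\<close>,
  whose linearization error is quadratic in deviations of order \<open>1 / \<surd>n\<close>.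
\<close>

section \<open>Integrals of quantile functions\<close>

context right_continuous_mono
begin

lemma lower_bound: "a \<le> f x"
proof (rule tendsto_upperbound[OF bot])
  show "\<forall>\<^sub>F y in at_bot. f y \<le> f x"
    using eventually_le_at_bot[of x] by eventually_elim (rule monoD[OF mono])
qed simp

lemma upper_bound: "f x \<le> b"
proof (rule tendsto_lowerbound[OF top])
  show "\<forall>\<^sub>F y in at_top. f x \<le> f y"
    using eventually_ge_at_top[of x] by eventually_elim (rule monoD[OF mono])
qed simp

end

text \<open>Infinite quantiles become \<open>0\<close>. For a cdf and \<open>u\<close> in [0,1] this
  can only happen at the endpoints, a null set for every integral below.\<close>

abbreviation rquantile :: "(real \<Rightarrow> real) \<Rightarrow> real \<Rightarrow> real" where
  "rquantile G u \<equiv> real_of_ereal (quantile G u)"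

context
  fixes G :: "real \<Rightarrow> real"
  assumes G: "right_continuous_mono G 0 1"
begin

interpretation right_continuous_mono G 0 1 by (rule G)

text \<open>Right continuity makes the superlevel set at height \<open>u\<close> a closed half-line,
  and the limits 0 and 1 make it nonempty and bounded below for \<open>0 < u < 1\<close>. The
  extended infimum is therefore attained and real.\<close>

lemma quantile_eq_Inf:
  assumes "0 < u" "u < 1"
  shows "quantile G u = ereal (I u)"
proof -
  have "quantile G u = (INF x\<in>{x. u \<le> G x}. ereal x)"
    using assms(1) by (simp add: quantile_def)
  also have "{x. u \<le> G x} = {I u..}"
    using pseudoinverse[OF assms] by blast
  also have "(INF x\<in>{I u..}. ereal x) = ereal (I u)"
    by (rule INF_eqI) auto
  finally show ?thesis .
qed

lemma quantile_eq_ereal: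
  "0 < u \<Longrightarrow> u < 1 \<Longrightarrow> quantile G u = ereal (rquantile G u)"
  by (simp add: quantile_eq_Inf)

text \<open>The Galois connection between quantile and cdf. Through it, monotonicity, measurability
  and consistency of quantiles reduce to statements about values of the cdf.\<close>

lemma rquantile_le_iff:
  "0 < u \<Longrightarrow> u < 1 \<Longrightarrow> rquantile G u \<le> x \<longleftrightarrow> u \<le> G x"
  using pseudoinverse[of u x] by (metis quantile_eq_Inf real_of_ereal.simps(1))

lemma rquantile_mono:
  assumes "0 < u" "u \<le> v" "v < 1"
  shows "rquantile G u \<le> rquantile G v"
proof -
  have "v \<le> G (rquantile G v)"
    using assms rquantile_le_iff[of v "rquantile G v"] by simp
  then show ?thesis using assms by (subst rquantile_le_iff) auto
qed

text \<open>Both sides come from the area of the region \<open>0 < u \<le> p\<close>,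
  \<open>u \<le> G x\<close>, \<open>x < q\<close> with \<open>q = rquantile G p\<close>. The slice
  at fixed \<open>u\<close> has length \<open>q - rquantile G u\<close>; the slice at fixed
  \<open>x\<close> has length \<open>G x\<close>, because \<open>x < q\<close> forces
  \<open>G x < p\<close>. Integrability of \<open>G\<close> on the half-line makes the area
  finite.\<close>

lemma integral_quantile:
  assumes p: "0 < p" "p < 1" and int: "set_integrable lborel {..rquantile G p} G"
  shows "(LBINT u:{0..p}. rquantile G u) =
    p * rquantile G p - (LBINT x:{..rquantile G p}. G x)"
proof -
  define q where "q = rquantile G p"
  define A where "A = (LBINT x:{..q}. G x)"
  \<comment> \<open>The point \<open>u = 0\<close> is left out: the real value given to the quantile
    there may exceed \<open>q\<close>, which would break nonnegativity of \<open>f\<close>.\<close>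
  define f where "f u = indicator {0<..p} u * (q - rquantile G u)" for u
  note [measurable] = borel_measurable_mono[OF mono]
  have meas: "(\<lambda>u. indicator {0<..p} u * rquantile G u) \<in> borel_measurable borel"
  proof -
    have "rquantile G \<in> borel_measurable (restrict_space borel {0<..p})"
      using p by (intro borel_measurable_mono_on_fnc mono_onI rquantile_mono) auto
    then show ?thesis
      by (subst (asm) borel_measurable_restrict_space_iff) (auto simp: mult.commute)
  qed
  have f_meas[measurable]: "f \<in> borel_measurable borel"
  proof -
    have "f = (\<lambda>u. indicator {0<..p} u * q - indicator {0<..p} u * rquantile G u)"
      by (auto simp: f_def fun_eq_iff algebra_simps)
    then show ?thesis using meas by simp
  qed
  have f_nonneg: "0 \<le> f u" for u
    using p by (auto simp: f_def q_def indicator_def intro: rquantile_mono)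
  have "(\<integral>\<^sup>+u. ennreal (f u) \<partial>lborel) =
    (\<integral>\<^sup>+u. \<integral>\<^sup>+x. indicator {(u, x). 0 < u \<and> u \<le> p \<and> u \<le> G x \<and> x < q} (u, x) \<partial>lborel \<partial>lborel)"
  proof (rule nn_integral_cong)
    fix u :: real
    show "ennreal (f u) =
      (\<integral>\<^sup>+x. indicator {(u, x). 0 < u \<and> u \<le> p \<and> u \<le> G x \<and> x < q} (u, x) \<partial>lborel)"
    proof (cases "0 < u \<and> u \<le> p")
      case True
      then have "(\<lambda>x. indicator {(u, x). 0 < u \<and> u \<le> p \<and> u \<le> G x \<and> x < q} (u, x)) =
        (indicator {rquantile G u..<q} :: _ \<Rightarrow> ennreal)"
        using p rquantile_le_iff[of u] by (auto simp: fun_eq_iff indicator_def)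
      moreover have "rquantile G u \<le> q"
        using True p by (auto simp: q_def intro: rquantile_mono)
      ultimately show ?thesis using True by (simp add: f_def)
    qed (auto simp: f_def)
  qed
  also have "\<dots> = (\<integral>\<^sup>+x. \<integral>\<^sup>+u. indicator {(u, x). 0 < u \<and> u \<le> p \<and> u \<le> G x \<and> x < q} (u, x) \<partial>lborel \<partial>lborel)"
    by (rule lborel_pair.Fubini') measurable
  also have "\<dots> = (\<integral>\<^sup>+x. ennreal (indicator {..<q} x * G x) \<partial>lborel)"
  proof (rule nn_integral_cong)
    fix x :: real
    have "(\<lambda>u. indicator {(u, x). 0 < u \<and> u \<le> p \<and> u \<le> G x \<and> x < q} (u, x)) =
        (indicator {0<..G x} :: _ \<Rightarrow> ennreal)" if "x < q"
      using p that rquantile_le_iff[of p x] by (auto simp: fun_eq_iff indicator_def q_def)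
    then show "(\<integral>\<^sup>+u. indicator {(u, x). 0 < u \<and> u \<le> p \<and> u \<le> G x \<and> x < q} (u, x) \<partial>lborel)
      = ennreal (indicator {..<q} x * G x)"
      using lower_bound[of x] by (cases "x < q") auto
  qed
  also have "\<dots> = (\<integral>\<^sup>+x. ennreal (indicator {..q} x * G x) \<partial>lborel)"
    by (intro nn_integral_cong_AE eventually_mono[OF AE_lborel_singleton[of q]])
       (auto simp: indicator_def)
  also have "\<dots> = ennreal A"
    using int lower_bound unfolding A_def q_def set_lebesgue_integral_def set_integrable_def
    by (subst nn_integral_eq_integral) auto
  finally have "has_bochner_integral lborel f A"
    using lower_bound f_nonneg
    by (intro has_bochner_integral_nn_integral)
       (auto simp: A_def set_lebesgue_integral_def intro!: integral_nonneg_AE)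
  moreover have "has_bochner_integral lborel (\<lambda>u. indicator {0<..p} u * q) (p * q)"
    using p has_bochner_integral_mult_left[OF has_bochner_integral_real_indicator[of "{0<..p}" lborel], of q]
    by (simp add: mult.commute)
  ultimately have "has_bochner_integral lborel (\<lambda>u. indicator {0<..p} u * q - f u) (p * q - A)"
    by (rule has_bochner_integral_diff[rotated])
  then have "p * q - A = (LBINT u. indicator {0<..p} u * q - f u)"
    by (simp add: has_bochner_integral_integral_eq)
  also have "\<dots> = (LBINT u:{0<..p}. rquantile G u)"
    unfolding set_lebesgue_integral_def
    by (intro Bochner_Integration.integral_cong) (auto simp: f_def algebra_simps)
  \<comment> \<open>The endpoint 0 is a null set. Splitting off the single value there also shows
    that the integrand over the closed interval is measurable.\<close>
  also have "\<dots> = (LBINT u:{0..p}. rquantile G u)"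
  proof -
    have "indicat_real {0..p} u *\<^sub>R rquantile G u = indicator {0<..p} u *\<^sub>R rquantile G u + indicator {0} u * rquantile G 0" for u
      using p by (auto simp: indicator_def)
    moreover have "(\<lambda>u. indicat_real {0<..p} u *\<^sub>R rquantile G u) \<in> borel_measurable borel"
      using meas by simp
    ultimately show ?thesis unfolding set_lebesgue_integral_def
      by (intro integral_cong_AE eventually_mono[OF AE_lborel_singleton[of 0]])
         (auto simp: indicator_def)
  qed
  finally show ?thesis by (simp add: q_def A_def)
qed

end

text \<open>Between the two quantiles, \<open>p\<close> lies between \<open>G x\<close> and \<open>H x\<close>.\<close>

lemma rquantile_remainder:
  fixes G H :: "real \<Rightarrow> real" and p d :: real
  defines "r \<equiv> rquantile G p" and "q \<equiv> rquantile H p"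
  assumes G: "right_continuous_mono G 0 1" and H: "right_continuous_mono H 0 1"
    and p: "0 < p" "p < 1" and d: "\<bar>r - q\<bar> \<le> d"
    and int: "\<And>t. set_integrable lborel {..t} G"
  shows "\<bar>(p * r - (LBINT x:{..r}. G x)) - (p * q - (LBINT x:{..q}. G x))\<bar>
    \<le> (LBINT x:{q-d..q+d}. \<bar>G x - H x\<bar>)"
proof -
  interpret G: right_continuous_mono G 0 1 by (rule G)
  interpret H: right_continuous_mono H 0 1 by (rule H)
  note [measurable] = borel_measurable_mono[OF G.mono] borel_measurable_mono[OF H.mono]
  have bound: "\<bar>G x - H x\<bar> \<le> 1" for x
    using G.lower_bound[of x] G.upper_bound[of x] H.lower_bound[of x] H.upper_bound[of x] by linarith
  have near: "\<bar>p - G x\<bar> \<le> \<bar>G x - H x\<bar>" if "min q r \<le> x" "x < max q r" for x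
    using that rquantile_le_iff[OF G p, of x] rquantile_le_iff[OF H p, of x]
    by (auto simp: q_def r_def min_def max_def split: if_splits)
  have dint: "set_integrable lborel {q-d..q+d} (\<lambda>x. \<bar>G x - H x\<bar>)"
    by (rule set_integrable_bound[of _ _ "\<lambda>_. 1 :: real"])
       (use bound in \<open>auto simp: set_integrable_def set_borel_measurable_def emeasure_lborel_Icc_eq\<close>)
  \<comment> \<open>Half-open intervals fit \<open>near\<close>, which can fail at the right
    endpoint: at the larger quantile both cdfs are already at least \<open>p\<close>.\<close>
  have split: "(LBINT x:{..t}. G x) - (LBINT x:{..s}. G x) = (LBINT x:{s..<t}. G x)" if "s \<le> t" for s t
  proof -
    have 1: "set_integrable lborel {..<s} G" "set_integrable lborel {s..<t} G" "set_integrable lborel {..<t} G"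
      by (rule set_integrable_subset[OF int[of t]] set_integrable_subset[OF int[of s]]; auto)+
    have 2: "(LBINT x:{..u}. G x) = (LBINT x:{..<u}. G x)" for u
      unfolding set_lebesgue_integral_def
      by (intro integral_cong_AE eventually_mono[OF AE_lborel_singleton[of u]]) (auto simp: indicator_def)
    have "(LBINT x:{..<s} \<union> {s..<t}. G x) = (LBINT x:{..<s}. G x) + (LBINT x:{s..<t}. G x)"
      by (rule set_integral_Un[OF _ 1(1,2)]) auto
    also have "{..<s} \<union> {s..<t} = {..<t}" using that by auto
    finally show ?thesis unfolding 2 by linarith
  qed
  \<comment> \<open>Up to sign, the difference of the two functionals is the integral of
    \<open>p - G x\<close> between the quantiles. By \<open>near\<close> the integrand is dominated
    by \<open>\<bar>G x - H x\<bar>\<close>, and by \<open>d\<close> the interval lies in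
    \<open>{q-d..q+d}\<close>.\<close>
  have key: "\<bar>p * (t - s) - (LBINT x:{s..<t}. G x)\<bar> \<le> (LBINT x:{q-d..q+d}. \<bar>G x - H x\<bar>)"
    if "s \<le> t" and st: "s = min q r" "t = max q r" for s t
  proof -
    have i: "set_integrable lborel {s..<t} G"
      by (rule set_integrable_subset[OF int[of t]]) auto
    have ip: "set_integrable lborel {s..<t} (\<lambda>_. p)"
      unfolding set_integrable_def
      using \<open>s \<le> t\<close> by (intro integrable_scaleR_left integrable_real_indicator) auto
    have "p * (t - s) - (LBINT x:{s..<t}. G x) = (LBINT x:{s..<t}. p - G x)"
      using \<open>s \<le> t\<close> by (subst set_integral_diff(2)[OF ip i]) (simp add: set_lebesgue_integral_def)
    also have "\<bar>\<dots>\<bar> \<le> (LBINT x:{s..<t}. \<bar>p - G x\<bar>)"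
      using set_integral_norm_bound[OF set_integral_diff(1)[OF ip i]] by simp
    also have "\<dots> \<le> (LBINT x:{s..<t}. \<bar>G x - H x\<bar>)"
    proof (rule set_integral_mono)
      show "set_integrable lborel {s..<t} (\<lambda>x. \<bar>p - G x\<bar>)"
        by (rule set_integrable_abs[OF set_integral_diff(1)[OF ip i]])
      show "set_integrable lborel {s..<t} (\<lambda>x. \<bar>G x - H x\<bar>)"
        by (rule set_integrable_subset[OF dint]) (use st d in auto)
    qed (use near st in auto)
    also have "\<dots> \<le> (LBINT x:{q-d..q+d}. \<bar>G x - H x\<bar>)"
      unfolding set_lebesgue_integral_def
      by (intro integral_mono' dint[unfolded set_integrable_def])
         (use st d in \<open>auto simp: indicator_def\<close>)
    finally show ?thesis .
  qed
  show ?thesis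
  proof (cases "q \<le> r")
    case True
    then show ?thesis using key[of q r] split[of q r] by (simp add: algebra_simps)
  next
    case False
    then show ?thesis using key[of r q] split[of r q] by (simp add: algebra_simps abs_minus_commute)
  qed
qed

section \<open>Empirical distribution functions and iid samples\<close>

text \<open>The integrand is the indicator of \<open>{y..t}\<close>, empty when
  \<open>t < y\<close>. Averaging over the sample, or taking expectations, turns the integral of a
  cdf up to \<open>t\<close> into a mean of \<open>max 0 (t - y)\<close>.\<close>

lemma has_bochner_integral_indicator_atMost:
  fixes y t :: real
  shows "has_bochner_integral lborel (\<lambda>x. indicator {..t} x *\<^sub>R indicator {..x} y) (max 0 (t - y))"
proof -
  have "has_bochner_integral lborel (indicator {y..t} :: real \<Rightarrow> real) (measure lborel {y..t})"
    by (rule has_bochner_integral_real_indicator) (auto simp: emeasure_lborel_Icc_eq)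
  also have "(indicator {y..t} :: real \<Rightarrow> real) = (\<lambda>x. indicator {..t} x *\<^sub>R indicator {..x} y)"
    by (auto simp: indicator_def fun_eq_iff)
  also have "measure lborel {y..t} = max 0 (t - y)"
    by (cases "y \<le> t") auto
  finally show ?thesis .
qed

text \<open>Each summand is eventually constant to the right of any point and near both infinities.
  The bound \<open>n \<ge> 1\<close> gives the limit 1 at infinity: for \<open>n = 0\<close> the
  function vanishes identically.\<close>

lemma right_continuous_mono_empirical_cdf:
  assumes "n \<ge> 1"
  shows "right_continuous_mono (empirical_cdf X n \<omega>) 0 1"
proof
  fix x :: real
  have *: "((\<lambda>y. indicator {..y} c :: real) \<longlongrightarrow> indicator {..x} c) (at_right x)" for c
  proof (cases "c \<le> x")
    case True
    then show ?thesis
      by (intro tendsto_eventually eventually_mono[OF eventually_at_right_less]) auto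
  next
    case False
    then show ?thesis
      by (intro tendsto_eventually eventually_mono[OF eventually_at_right_real[of x c]]) auto
  qed
  show "continuous (at_right x) (empirical_cdf X n \<omega>)"
    unfolding continuous_within empirical_cdf_def
    by (intro tendsto_intros *)
next
  show "mono (empirical_cdf X n \<omega>)"
    unfolding empirical_cdf_def
    by (intro monoI mult_left_mono sum_mono) (auto simp: indicator_def)
next
  have *: "((\<lambda>y. indicator {..y} c :: real) \<longlongrightarrow> 0) at_bot" for c :: real
    by (intro tendsto_eventually eventually_mono[OF eventually_gt_at_bot[of c]]) auto
  have "((\<lambda>y. 1 / real n * (\<Sum>i=1..n. indicator {..y} (X i \<omega>))) \<longlongrightarrow> 1 / real n * (\<Sum>i=1..n. 0)) at_bot"
    by (intro tendsto_intros *)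
  then show "(empirical_cdf X n \<omega> \<longlongrightarrow> 0) at_bot"
    by (simp add: empirical_cdf_def[abs_def])
next
  have *: "((\<lambda>y. indicator {..y} c :: real) \<longlongrightarrow> 1) at_top" for c :: real
    by (intro tendsto_eventually eventually_mono[OF eventually_ge_at_top[of c]]) auto
  have "((\<lambda>y. 1 / real n * (\<Sum>i=1..n. indicator {..y} (X i \<omega>))) \<longlongrightarrow> 1 / real n * (\<Sum>i=1..n. 1)) at_top"
    by (intro tendsto_intros *)
  then show "(empirical_cdf X n \<omega> \<longlongrightarrow> 1) at_top"
    using assms by (simp add: empirical_cdf_def[abs_def])
qed

text \<open>A common form for the sample mean, the empirical cdf at a point and its integral over a
  half-line, so that one variance bound serves all three.\<close>

definition sample_avg :: "(nat \<Rightarrow> 'a \<Rightarrow> real) \<Rightarrow> (real \<Rightarrow> real) \<Rightarrow> nat \<Rightarrow> 'a \<Rightarrow> real" where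
  "sample_avg X f n \<omega> = 1 / real n * (\<Sum>i=1..n. f (X i \<omega>))"

lemma has_bochner_integral_empirical_cdf:
  "has_bochner_integral lborel (\<lambda>x. indicator {..t} x *\<^sub>R empirical_cdf X n \<omega> x)
    (sample_avg X (\<lambda>y. max 0 (t - y)) n \<omega>)"
proof -
  have "has_bochner_integral lborel
    (\<lambda>x. 1 / real n * (\<Sum>i=1..n. indicator {..t} x *\<^sub>R indicator {..x} (X i \<omega>)))
    (sample_avg X (\<lambda>y. max 0 (t - y)) n \<omega>)"
    unfolding sample_avg_def
    by (intro has_bochner_integral_mult_right has_bochner_integral_sum
        has_bochner_integral_indicator_atMost)
  moreover have "1 / real n * (\<Sum>i=1..n. indicator {..t} x *\<^sub>R indicator {..x} (X i \<omega>)) =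
      indicator {..t} x *\<^sub>R empirical_cdf X n \<omega> x" for x
    by (cases "x \<le> t") (auto simp: empirical_cdf_def)
  ultimately show ?thesis by (simp only:)
qed

section \<open>Second moments of averages over an iid sample\<close>

locale iid_sample = prob_space M for M :: "'a measure" +
  fixes X :: "nat \<Rightarrow> 'a \<Rightarrow> real" and F :: "real \<Rightarrow> real"
  assumes indep: "indep_vars (\<lambda>_. borel) X {1..}"
    and cdf_eq: "i \<ge> 1 \<Longrightarrow> cdf (distr M borel (X i)) = F"
begin

lemma measurable_X [measurable (raw)]: "i \<ge> 1 \<Longrightarrow> X i \<in> borel_measurable M"
  using indep by (auto simp: indep_vars_def)

lemma distr_eq:
  assumes "i \<ge> 1"
  shows "distr M borel (X i) = distr M borel (X 1)"
  using assms cdf_eq[of i] cdf_eq[of 1] measurable_X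
  by (intro cdf_unique real_distribution_distr) auto

lemma
  fixes f :: "real \<Rightarrow> real"
  assumes [measurable]: "f \<in> borel_measurable borel" and i: "i \<ge> 1"
  shows integrable_comp_X: "integrable M (\<lambda>\<omega>. f (X i \<omega>)) \<longleftrightarrow> integrable M (\<lambda>\<omega>. f (X 1 \<omega>))"
    and expectation_comp_X: "expectation (\<lambda>\<omega>. f (X i \<omega>)) = expectation (\<lambda>\<omega>. f (X 1 \<omega>))"
proof -
  have [measurable]: "X i \<in> borel_measurable M" "X 1 \<in> borel_measurable M"
    using i measurable_X by auto
  show "integrable M (\<lambda>\<omega>. f (X i \<omega>)) \<longleftrightarrow> integrable M (\<lambda>\<omega>. f (X 1 \<omega>))"
    using distr_eq[OF i] integrable_distr_eq[of "X i" M borel f] integrable_distr_eq[of "X 1" M borel f]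
    by simp
  show "expectation (\<lambda>\<omega>. f (X i \<omega>)) = expectation (\<lambda>\<omega>. f (X 1 \<omega>))"
    using distr_eq[OF i] integral_distr[of "X i" M borel f] integral_distr[of "X 1" M borel f]
    by simp
qed

lemma F_eq_prob: "i \<ge> 1 \<Longrightarrow> F x = prob {\<omega>\<in>space M. X i \<omega> \<le> x}"
  using cdf_eq[of i] measurable_X[of i]
  by (auto simp: cdf_def measure_distr vimage_def Int_def intro!: arg_cong[of _ _ prob])

lemma right_continuous_mono_F: "right_continuous_mono F 0 1"
proof -
  interpret D: cdf_distribution "distr M borel (X 1)"
    using measurable_X by (simp add: cdf_distribution_def real_distribution_distr)
  show ?thesis
    using D.right_continuous_mono_axioms cdf_eq[of 1] by simp
qed

lemma sample_avg_measurable [measurable]: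
  assumes [measurable]: "f \<in> borel_measurable borel"
  shows "sample_avg X f n \<in> borel_measurable M"
  unfolding sample_avg_def
  by (intro borel_measurable_times borel_measurable_sum borel_measurable_const
      measurable_compose[OF measurable_X assms]) auto

text \<open>Expanding the square of the centred sum, independence kills the off-diagonal terms and
  the \<open>n\<close> diagonal ones each give the variance. The variance is then bounded by the raw
  second moment, which is enough for rates.\<close>

lemma
  fixes f :: "real \<Rightarrow> real"
  assumes [measurable]: "f \<in> borel_measurable borel"
    and int: "integrable M (\<lambda>\<omega>. (f (X 1 \<omega>))\<^sup>2)" and n: "n \<ge> 1"
  defines "m \<equiv> expectation (\<lambda>\<omega>. f (X 1 \<omega>))"
  shows integrable_sample_avg_sq: "integrable M (\<lambda>\<omega>. (sample_avg X f n \<omega> - m)\<^sup>2)"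
    and expectation_sample_avg_sq:
      "expectation (\<lambda>\<omega>. (sample_avg X f n \<omega> - m)\<^sup>2) \<le> expectation (\<lambda>\<omega>. (f (X 1 \<omega>))\<^sup>2) / real n"
proof -
  define Y where "Y i \<omega> = f (X i \<omega>) - m" for i \<omega>
  define v where "v = expectation (\<lambda>\<omega>. (Y 1 \<omega>)\<^sup>2)"
  have X1 [measurable]: "X 1 \<in> borel_measurable M" by (rule measurable_X) simp
  have f1: "integrable M (\<lambda>\<omega>. f (X 1 \<omega>))"
    by (rule square_integrable_imp_integrable[OF _ int]) measurable
  have intY: "integrable M (Y i)" and EY: "expectation (Y i) = 0" if "i \<ge> 1" for i
    using f1 integrable_comp_X[of f i] expectation_comp_X[of f i] that
    by (auto simp: Y_def[abs_def] prob_space m_def)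
  have sq: "integrable M (\<lambda>\<omega>. (f (X 1 \<omega>) - m)\<^sup>2)"
    using f1 int by (simp add: power2_diff)
  have intY2: "integrable M (\<lambda>\<omega>. (Y i \<omega>)\<^sup>2)" and EY2: "expectation (\<lambda>\<omega>. (Y i \<omega>)\<^sup>2) = v" if "i \<ge> 1" for i
    using sq integrable_comp_X[of "\<lambda>x. (f x - m)\<^sup>2" i] expectation_comp_X[of "\<lambda>x. (f x - m)\<^sup>2" i] that
    by (auto simp: Y_def v_def)
  have indepY: "indep_var borel (Y i) borel (Y j)" if "i \<ge> 1" "j \<ge> 1" "i \<noteq> j" for i j
  proof -
    have "indep_vars (\<lambda>_. borel) Y {1..}"
      unfolding Y_def[abs_def] by (rule indep_vars_compose2[OF indep]) measurable
    then have "indep_vars (\<lambda>_. borel) Y (insert i {j})"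
      by (rule indep_vars_subset) (use that in auto)
    \<comment> \<open>A sum over the singleton \<open>{j}\<close> is \<open>Y j\<close>, so
      independence of \<open>Y i\<close> from that sum is pairwise independence.\<close>
    from indep_vars_sum[OF _ _ this] show ?thesis using that by simp
  qed
  have intYY: "integrable M (\<lambda>\<omega>. Y i \<omega> * Y j \<omega>)"
    and EYY: "expectation (\<lambda>\<omega>. Y i \<omega> * Y j \<omega>) = (if i = j then v else 0)" if "i \<ge> 1" "j \<ge> 1" for i j
    using that intY2[of i] EY2[of i] indep_var_integrable[OF indepY[of i j] intY intY]
      indep_var_lebesgue_integral[OF indepY[of i j] intY intY] EY
    by (cases "i = j"; force simp: power2_eq_square)+
  have eq: "(sample_avg X f n \<omega> - m)\<^sup>2 = 1 / (real n)\<^sup>2 * (\<Sum>i=1..n. \<Sum>j=1..n. Y i \<omega> * Y j \<omega>)" for \<omega>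
  proof -
    have "sample_avg X f n \<omega> - m = 1 / real n * (\<Sum>i=1..n. Y i \<omega>)"
      using n by (simp add: sample_avg_def Y_def sum_subtractf field_simps)
    then show ?thesis
      by (simp add: power2_eq_square sum_product)
  qed
  show "integrable M (\<lambda>\<omega>. (sample_avg X f n \<omega> - m)\<^sup>2)"
    unfolding eq
    by (intro integrable_mult_right Bochner_Integration.integrable_sum intYY) auto
  have "expectation (\<lambda>\<omega>. (sample_avg X f n \<omega> - m)\<^sup>2) =
      1 / (real n)\<^sup>2 * (\<Sum>i=1..n. \<Sum>j=1..n. expectation (\<lambda>\<omega>. Y i \<omega> * Y j \<omega>))"
    unfolding eq
    by (subst Bochner_Integration.integral_mult_right_zero, subst Bochner_Integration.integral_sum,
        (intro Bochner_Integration.integrable_sum intYY; simp),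
        intro arg_cong2[where f = "(*)"] sum.cong refl Bochner_Integration.integral_sum intYY) auto
  also have "\<dots> = 1 / (real n)\<^sup>2 * (\<Sum>i=1..n. \<Sum>j=1..n. if i = j then v else 0)"
    using EYY by simp
  also have "\<dots> = v / real n"
    using n by (simp add: power2_eq_square)
  also have "v \<le> expectation (\<lambda>\<omega>. (f (X 1 \<omega>))\<^sup>2)"
    using variance_eq[OF f1 int] by (simp add: v_def Y_def m_def)
  finally show "expectation (\<lambda>\<omega>. (sample_avg X f n \<omega> - m)\<^sup>2) \<le> expectation (\<lambda>\<omega>. (f (X 1 \<omega>))\<^sup>2) / real n"
    by (simp add: divide_right_mono)
qed

text \<open>\<open>F x\<close> is the expectation of \<open>indicator {..x} (X 1 \<omega>)\<close>.
  Tonelli moves the expectation outside, and the inner integral over \<open>x\<close> is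
  \<open>max 0 (t - X 1 \<omega>)\<close>. This is the population counterpart of
  \<open>has_bochner_integral_empirical_cdf\<close>.\<close>

lemma has_bochner_integral_F:
  assumes "integrable M (X 1)"
  shows "has_bochner_integral lborel (\<lambda>x. indicator {..t} x *\<^sub>R F x)
    (expectation (\<lambda>\<omega>. max 0 (t - X 1 \<omega>)))"
proof -
  interpret F: right_continuous_mono F 0 1 by (rule right_continuous_mono_F)
  interpret pair_sigma_finite lborel M
    by (intro pair_sigma_finite.intro sigma_finite_lborel sigma_finite_measure_axioms)
  note [measurable] = borel_measurable_mono[OF F.mono]
  have X1 [measurable]: "X 1 \<in> borel_measurable M" by (rule measurable_X) simp
  have "(\<integral>\<^sup>+x. ennreal (indicator {..t} x *\<^sub>R F x) \<partial>lborel) =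
    (\<integral>\<^sup>+x. \<integral>\<^sup>+\<omega>. ennreal (indicator {..t} x *\<^sub>R indicator {..x} (X 1 \<omega>)) \<partial>M \<partial>lborel)"
  proof (rule nn_integral_cong)
    fix x :: real
    have "(\<integral>\<^sup>+\<omega>. ennreal (indicator {..x} (X 1 \<omega>)) \<partial>M) =
        (\<integral>\<^sup>+\<omega>. indicator {\<omega>\<in>space M. X 1 \<omega> \<le> x} \<omega> \<partial>M)"
      by (intro nn_integral_cong) (auto simp: indicator_def)
    also have "\<dots> = ennreal (F x)"
      by (simp add: F_eq_prob[of 1] emeasure_eq_measure)
    finally show "ennreal (indicator {..t} x *\<^sub>R F x) =
        (\<integral>\<^sup>+\<omega>. ennreal (indicator {..t} x *\<^sub>R indicator {..x} (X 1 \<omega>)) \<partial>M)"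
      by (cases "x \<le> t") auto
  qed
  also have "\<dots> = (\<integral>\<^sup>+\<omega>. \<integral>\<^sup>+x. ennreal (indicator {..t} x *\<^sub>R indicator {..x} (X 1 \<omega>)) \<partial>lborel \<partial>M)"
  proof (rule Fubini'[symmetric])
    \<comment> \<open>The set \<open>{..x}\<close> varies with the integration variable; joint
      measurability appears once the integrand is the indicator of one fixed set in the product
      space.\<close>
    have "(\<lambda>(x, \<omega>). ennreal (indicator {..t} x *\<^sub>R indicator {..x} (X 1 \<omega>))) =
       (\<lambda>z. indicator {z. fst z \<le> t \<and> X 1 (snd z) \<le> fst z} z)"
      by (auto simp: indicator_def fun_eq_iff)
    moreover have "{z\<in>space (lborel \<Otimes>\<^sub>M M). fst z \<le> t \<and> X 1 (snd z) \<le> fst z} \<in> sets (lborel \<Otimes>\<^sub>M M)"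
      by measurable
    ultimately show "(\<lambda>(x, \<omega>). ennreal (indicator {..t} x *\<^sub>R indicator {..x} (X 1 \<omega>)))
        \<in> borel_measurable (lborel \<Otimes>\<^sub>M M)"
      by (simp add: borel_measurable_indicator_iff Int_def conj_commute)
  qed
  also have "\<dots> = (\<integral>\<^sup>+\<omega>. ennreal (max 0 (t - X 1 \<omega>)) \<partial>M)"
  proof (rule nn_integral_cong)
    fix \<omega>
    show "(\<integral>\<^sup>+x. ennreal (indicator {..t} x *\<^sub>R indicator {..x} (X 1 \<omega>)) \<partial>lborel) = ennreal (max 0 (t - X 1 \<omega>))"
      using has_bochner_integral_indicator_atMost[of t "X 1 \<omega>"]
      by (subst nn_integral_eq_integral) (auto simp: has_bochner_integral_iff)
  qed
  also have "\<dots> = ennreal (expectation (\<lambda>\<omega>. max 0 (t - X 1 \<omega>)))"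
    using assms by (intro nn_integral_eq_integral) auto
  finally show ?thesis
    using F.lower_bound by (intro has_bochner_integral_nn_integral) auto
qed

end

text \<open>The bound is asked only for \<open>n \<ge> 1\<close> because the sample estimates divide
  by \<open>n\<close>.\<close>

lemma measure_tendsto_0I:
  fixes b :: "nat \<Rightarrow> real"
  assumes "\<And>n. n \<ge> 1 \<Longrightarrow> measure M (A n) \<le> b n" "b \<longlonglongrightarrow> 0"
  shows "(\<lambda>n. measure M (A n)) \<longlonglongrightarrow> 0"
  by (rule tendsto_sandwich[OF always_eventually eventually_sequentiallyI tendsto_const assms(2)])
     (use assms(1) in auto)

lemma set_integrable_empirical_cdf: "set_integrable lborel {..t} (empirical_cdf X n \<omega>)"
  using has_bochner_integral_empirical_cdf[of t X n \<omega>]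
  by (simp add: set_integrable_def has_bochner_integral_iff)

lemma integral_empirical_cdf:
  "(LBINT x:{..t}. empirical_cdf X n \<omega> x) = sample_avg X (\<lambda>y. max 0 (t - y)) n \<omega>"
  using has_bochner_integral_empirical_cdf[of t X n \<omega>]
  by (simp add: set_lebesgue_integral_def has_bochner_integral_iff)

section \<open>Deviations of sample averages and of the empirical cdf\<close>

context iid_sample
begin

lemma empirical_cdf_eq_sample_avg: "empirical_cdf X n \<omega> x = sample_avg X (indicator {..x}) n \<omega>"
  by (simp add: empirical_cdf_def sample_avg_def)

lemma empirical_cdf_measurable [measurable]: "(\<lambda>\<omega>. empirical_cdf X n \<omega> x) \<in> borel_measurable M"
  unfolding empirical_cdf_eq_sample_avg by measurable

text \<open>Chebyshev's inequality combined with \<open>expectation_sample_avg_sq\<close>.\<close>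

lemma prob_sample_avg_deviation:
  assumes [measurable]: "f \<in> borel_measurable borel"
    and int: "integrable M (\<lambda>\<omega>. (f (X 1 \<omega>))\<^sup>2)" and "n \<ge> 1" "\<eta> > 0"
  shows "prob {\<omega>\<in>space M. \<eta> \<le> \<bar>sample_avg X f n \<omega> - expectation (\<lambda>\<omega>. f (X 1 \<omega>))\<bar>}
    \<le> expectation (\<lambda>\<omega>. (f (X 1 \<omega>))\<^sup>2) / real n / \<eta>\<^sup>2"
proof -
  define Z where "Z \<omega> = sample_avg X f n \<omega> - expectation (\<lambda>\<omega>. f (X 1 \<omega>))" for \<omega>
  have [measurable]: "Z \<in> borel_measurable M"
    unfolding Z_def by measurable
  have "prob {\<omega>\<in>space M. \<eta> \<le> \<bar>Z \<omega>\<bar>} \<le> expectation (\<lambda>\<omega>. (Z \<omega>)\<^sup>2) / \<eta>\<^sup>2"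
    by (rule second_moment_method) (use assms integrable_sample_avg_sq[of f n] in \<open>auto simp: Z_def\<close>)
  also have "\<dots> \<le> expectation (\<lambda>\<omega>. (f (X 1 \<omega>))\<^sup>2) / real n / \<eta>\<^sup>2"
    unfolding Z_def by (intro divide_right_mono expectation_sample_avg_sq assms) auto
  finally show ?thesis by (simp add: Z_def)
qed

lemma prob_sample_avg_deviation_tendsto_0:
  assumes "f \<in> borel_measurable borel" "integrable M (\<lambda>\<omega>. (f (X 1 \<omega>))\<^sup>2)" "\<eta> > 0"
  shows "(\<lambda>n. prob {\<omega>\<in>space M. \<eta> \<le> \<bar>sample_avg X f n \<omega> - expectation (\<lambda>\<omega>. f (X 1 \<omega>))\<bar>})
    \<longlonglongrightarrow> 0"
  by (rule measure_tendsto_0I[OF prob_sample_avg_deviation[OF assms(1,2) _ assms(3)]])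
     (assumption | rule tendsto_divide_zero lim_const_over_n)+

lemma expectation_indicator_X: "expectation (\<lambda>\<omega>. indicator {..x} (X 1 \<omega>)) = F x"
proof -
  have X1 [measurable]: "X 1 \<in> borel_measurable M" by (rule measurable_X) simp
  have "expectation (\<lambda>\<omega>. indicator {..x} (X 1 \<omega>)) = expectation (indicator {\<omega>\<in>space M. X 1 \<omega> \<le> x})"
    by (intro Bochner_Integration.integral_cong) (auto simp: indicator_def)
  also have "\<dots> = F x" by (simp add: F_eq_prob[of 1])
  finally show ?thesis .
qed

lemma integrable_indicator_X_sq: "integrable M (\<lambda>\<omega>. (indicat_real {..x} (X 1 \<omega>))\<^sup>2)"
proof -
  have X1 [measurable]: "X 1 \<in> borel_measurable M" by (rule measurable_X) simp
  show ?thesis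
    by (rule integrable_const_bound[where B = 1]) (auto simp: indicator_def)
qed

text \<open>A squared indicator is at most 1, so the mean square deviation is at most
  \<open>1 / real n\<close>, uniformly in \<open>x\<close>. The form as a nonnegative integral lets
  the bound be inserted directly after Tonelli.\<close>

lemma nn_integral_empirical_cdf_deviation:
  assumes n: "n \<ge> 1"
  shows "(\<integral>\<^sup>+\<omega>. ennreal \<bar>empirical_cdf X n \<omega> x - F x\<bar> \<partial>M) \<le> ennreal (1 / sqrt (real n))"
proof -
  define Z where "Z \<omega> = empirical_cdf X n \<omega> x - F x" for \<omega>
  \<comment> \<open>With this weight both terms of the AM-GM bound below have mean at most
    \<open>1 / (2 * s)\<close>, so together they give \<open>1 / s\<close>.\<close>
  define s where "s = sqrt (real n)"
  have s: "s > 0" "s * s = real n" using n by (auto simp: s_def)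
  have sqX: "expectation (\<lambda>\<omega>. (indicat_real {..x} (X 1 \<omega>))\<^sup>2) \<le> 1"
    using integrable_indicator_X_sq by (intro integral_le_const) (auto simp: indicator_def)
  have intZ: "integrable M (\<lambda>\<omega>. (Z \<omega>)\<^sup>2)"
    and "expectation (\<lambda>\<omega>. (Z \<omega>)\<^sup>2) \<le> expectation (\<lambda>\<omega>. (indicat_real {..x} (X 1 \<omega>))\<^sup>2) / real n"
    using integrable_sample_avg_sq[OF _ integrable_indicator_X_sq n, of x]
      expectation_sample_avg_sq[OF _ integrable_indicator_X_sq n, of x]
    by (auto simp: Z_def expectation_indicator_X empirical_cdf_eq_sample_avg simp del: One_nat_def)
  then have EZ: "expectation (\<lambda>\<omega>. (Z \<omega>)\<^sup>2) \<le> 1 / real n"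
    using sqX by (meson divide_right_mono of_nat_0_le_iff order_trans)
  \<comment> \<open>AM-GM in place of Cauchy--Schwarz\<close>
  have amgm: "\<bar>Z \<omega>\<bar> \<le> (s * (Z \<omega>)\<^sup>2 + 1 / s) / 2" for \<omega>
  proof -
    have "0 \<le> (s * \<bar>Z \<omega>\<bar> - 1)\<^sup>2 / s" using s by simp
    also have "\<dots> = s * (Z \<omega>)\<^sup>2 - 2 * \<bar>Z \<omega>\<bar> + 1 / s"
      using s by (simp add: field_simps power2_eq_square)
    finally show ?thesis by simp
  qed
  have "(\<integral>\<^sup>+\<omega>. ennreal \<bar>Z \<omega>\<bar> \<partial>M) \<le> (\<integral>\<^sup>+\<omega>. ennreal ((s * (Z \<omega>)\<^sup>2 + 1 / s) / 2) \<partial>M)"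
    by (intro nn_integral_mono ennreal_leI amgm)
  also have "\<dots> = ennreal (expectation (\<lambda>\<omega>. (s * (Z \<omega>)\<^sup>2 + 1 / s) / 2))"
    using intZ s by (intro nn_integral_eq_integral) auto
  also have "expectation (\<lambda>\<omega>. (s * (Z \<omega>)\<^sup>2 + 1 / s) / 2) = (s * expectation (\<lambda>\<omega>. (Z \<omega>)\<^sup>2) + 1 / s) / 2"
    using intZ by (simp add: prob_space)
  also have "\<dots> \<le> (s * (1 / real n) + 1 / s) / 2"
    using EZ s by (intro divide_right_mono add_mono mult_left_mono) auto
  also have "\<dots> = 1 / s"
    using s n by (simp add: field_simps)
  finally show ?thesis
    by (simp add: Z_def s_def ennreal_leI)
qed

lemma empirical_cdf_measurable_pair [measurable]:
  "(\<lambda>(\<omega>, x). empirical_cdf X n \<omega> x) \<in> borel_measurable (M \<Otimes>\<^sub>M lborel)"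
proof -
  have "(\<lambda>z. indicator {..snd z} (X i (fst z)) :: real) \<in> borel_measurable (M \<Otimes>\<^sub>M lborel)" if "i \<in> {1..n}" for i
  proof -
    have [measurable]: "X i \<in> borel_measurable M" using that by (intro measurable_X) auto
    have "(\<lambda>z. indicator {..snd z} (X i (fst z)) :: real) =
       (\<lambda>z. indicator {z. X i (fst z) \<le> snd z} z)"
      by (auto simp: indicator_def fun_eq_iff)
    moreover have "{z\<in>space (M \<Otimes>\<^sub>M lborel). X i (fst z) \<le> snd z} \<in> sets (M \<Otimes>\<^sub>M lborel)"
      by measurable
    ultimately show ?thesis
      by (simp add: borel_measurable_indicator_iff Int_def conj_commute)
  qed
  then show ?thesis
    unfolding empirical_cdf_def case_prod_beta
    by (intro borel_measurable_times borel_measurable_const borel_measurable_sum) auto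
qed

lemma integral_cdf_deviation_measurable:
  "(\<lambda>\<omega>. LBINT x:{a..b}. \<bar>empirical_cdf X n \<omega> x - F x\<bar>) \<in> borel_measurable M"
proof -
  note [measurable] = borel_measurable_mono[OF right_continuous_mono.mono[OF right_continuous_mono_F]]
  show ?thesis
    unfolding set_lebesgue_integral_def by measurable
qed

text \<open>Tonelli and the uniform pointwise bound give the integral mean at most
  \<open>(b - a) / sqrt (real n)\<close>; Markov's inequality follows. The factor
  \<open>sqrt (real n)\<close> cancels, leaving only the interval length, which can be made small
  independently of \<open>n\<close>.\<close>

lemma prob_integral_empirical_cdf_deviation:
  assumes n: "n \<ge> 1" and "a \<le> b" "\<eta> > 0"
  shows "prob {\<omega>\<in>space M. \<eta> \<le> sqrt (real n) * (LBINT x:{a..b}. \<bar>empirical_cdf X n \<omega> x - F x\<bar>)}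
    \<le> (b - a) / \<eta>"
proof -
  define D where "D \<omega> = (LBINT x:{a..b}. \<bar>empirical_cdf X n \<omega> x - F x\<bar>)" for \<omega>
  define g where "g \<omega> x = indicator {a..b} x *\<^sub>R \<bar>empirical_cdf X n \<omega> x - F x\<bar>" for \<omega> x
  interpret pair_sigma_finite M lborel
    by (intro pair_sigma_finite.intro sigma_finite_lborel sigma_finite_measure_axioms)
  interpret F: right_continuous_mono F 0 1 by (rule right_continuous_mono_F)
  note [measurable] = borel_measurable_mono[OF F.mono]
  have g_meas [measurable]: "(\<lambda>(\<omega>, x). g \<omega> x) \<in> borel_measurable (M \<Otimes>\<^sub>M lborel)"
    unfolding g_def by measurable
  have D_eq: "D \<omega> = (LBINT x. g \<omega> x)" for \<omega>
    by (simp add: D_def g_def set_lebesgue_integral_def)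
  have [measurable]: "D \<in> borel_measurable M"
    using integral_cdf_deviation_measurable by (simp add: D_def[abs_def])
  have D_nonneg: "0 \<le> D \<omega>" for \<omega>
    unfolding D_eq by (intro integral_nonneg_AE) (auto simp: g_def)
  have g_int: "integrable lborel (g \<omega>)" if "\<omega> \<in> space M" for \<omega>
  proof (rule Bochner_Integration.integrable_bound)
    show "integrable lborel (\<lambda>x. indicat_real {a..b} x)"
      by (auto simp: emeasure_lborel_Icc_eq)
    show "g \<omega> \<in> borel_measurable lborel"
      using that by measurable
    interpret G: right_continuous_mono "empirical_cdf X n \<omega>" 0 1
      by (rule right_continuous_mono_empirical_cdf[OF n])
    have "\<bar>empirical_cdf X n \<omega> x - F x\<bar> \<le> 1" for x
      using F.lower_bound[of x] F.upper_bound[of x] G.lower_bound[of x] G.upper_bound[of x]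
      by linarith
    then show "AE x in lborel. norm (g \<omega> x) \<le> norm (indicat_real {a..b} x)"
      by (auto simp: g_def indicator_def)
  qed
  have "(\<integral>\<^sup>+\<omega>. ennreal (D \<omega>) \<partial>M) = (\<integral>\<^sup>+\<omega>. \<integral>\<^sup>+x. ennreal (g \<omega> x) \<partial>lborel \<partial>M)"
  proof (rule nn_integral_cong)
    fix \<omega> assume "\<omega> \<in> space M"
    then show "ennreal (D \<omega>) = (\<integral>\<^sup>+x. ennreal (g \<omega> x) \<partial>lborel)"
      unfolding D_eq by (intro nn_integral_eq_integral[symmetric] g_int) (auto simp: g_def)
  qed
  also have "\<dots> = (\<integral>\<^sup>+x. \<integral>\<^sup>+\<omega>. ennreal (g \<omega> x) \<partial>M \<partial>lborel)"
    by (rule Fubini'[symmetric]) measurable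
  also have "\<dots> \<le> (\<integral>\<^sup>+x. ennreal (1 / sqrt (real n)) * indicator {a..b} x \<partial>lborel)"
  proof (rule nn_integral_mono)
    fix x :: real
    show "(\<integral>\<^sup>+\<omega>. ennreal (g \<omega> x) \<partial>M) \<le> ennreal (1 / sqrt (real n)) * indicator {a..b} x"
      using nn_integral_empirical_cdf_deviation[OF n, of x]
      by (cases "x \<in> {a..b}") (auto simp: g_def)
  qed
  also have "\<dots> = ennreal ((b - a) / sqrt (real n))"
    using \<open>a \<le> b\<close> by (simp add: nn_integral_cmult_indicator ennreal_mult[symmetric])
  finally have le: "(\<integral>\<^sup>+\<omega>. ennreal (D \<omega>) \<partial>M) \<le> ennreal ((b - a) / sqrt (real n))" .
  then have D_int: "integrable M D"
    using D_nonneg by (intro integrableI_nonneg) (auto simp: le_less_trans)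
  have "expectation D \<le> (b - a) / sqrt (real n)"
    using le nn_integral_eq_integral[OF D_int] D_nonneg \<open>a \<le> b\<close> by (simp add: ennreal_le_iff)
  moreover have "prob {\<omega>\<in>space M. sqrt (real n) * D \<omega> \<ge> \<eta>} \<le> expectation (\<lambda>\<omega>. sqrt (real n) * D \<omega>) / \<eta>"
    by (rule integral_Markov_inequality_measure[of _ _ "space M"])
       (use D_int D_nonneg \<open>\<eta> > 0\<close> in auto)
  moreover have "sqrt (real n) * ((b - a) / sqrt (real n)) = b - a"
    using n by simp
  ultimately show "prob {\<omega>\<in>space M. \<eta> \<le> sqrt (real n) * (LBINT x:{a..b}. \<bar>empirical_cdf X n \<omega> x - F x\<bar>)}
    \<le> (b - a) / \<eta>"
    using mult_left_mono[of "expectation D" "(b - a) / sqrt (real n)" "sqrt (real n)"] \<open>\<eta> > 0\<close>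
    by (simp add: D_def[symmetric] pos_le_divide_eq)
qed

section \<open>Consistency of the empirical quantile and the remainder term\<close>

context
  fixes p :: real
  assumes p: "0 < p" "p < 1"
begin

abbreviation "empirical_quantile n \<omega> \<equiv> rquantile (empirical_cdf X n \<omega>) p"

lemma empirical_quantile_le_iff:
  "n \<ge> 1 \<Longrightarrow> empirical_quantile n \<omega> \<le> x \<longleftrightarrow> p \<le> empirical_cdf X n \<omega> x"
  by (rule rquantile_le_iff[OF right_continuous_mono_empirical_cdf p])

lemma empirical_quantile_measurable:
  "n \<ge> 1 \<Longrightarrow> empirical_quantile n \<in> borel_measurable M"
  by (subst borel_measurable_iff_le) (simp add: empirical_quantile_le_iff)

lemma integral_empirical_quantile:
  assumes "n \<ge> 1"
  shows "(LBINT u:{0..p}. rquantile (empirical_cdf X n \<omega>) u) =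
    p * empirical_quantile n \<omega> - (LBINT x:{..empirical_quantile n \<omega>}. empirical_cdf X n \<omega> x)"
  by (rule integral_quantile[OF right_continuous_mono_empirical_cdf[OF assms] p
        set_integrable_empirical_cdf])

text \<open>The closed form is a finite expression in the empirical quantile and the observations,
  so joint measurability in \<open>\<omega>\<close> and \<open>u\<close> does not have to be
  studied.\<close>

lemma integral_empirical_quantile_measurable:
  assumes n: "n \<ge> 1"
  shows "(\<lambda>\<omega>. LBINT u:{0..p}. rquantile (empirical_cdf X n \<omega>) u) \<in> borel_measurable M"
  unfolding integral_empirical_quantile[OF n] integral_empirical_cdf sample_avg_def
  using empirical_quantile_measurable[OF n] measurable_X
  by (intro borel_measurable_diff borel_measurable_times borel_measurable_sum borel_measurable_max) auto

text \<open>This is where continuity at \<open>p\<close> enters: some \<open>u > p\<close> still has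
  its quantile below \<open>rquantile F p + d\<close>, hence
  \<open>p < u \<le> F (rquantile F p + d)\<close>. A flat stretch of \<open>F\<close> at height
  \<open>p\<close> is thereby excluded.\<close>

lemma less_F_right_of_quantile:
  assumes "isCont (quantile F) p" "d > 0"
  shows "p < F (rquantile F p + d)"
proof -
  note F = right_continuous_mono_F
  have "quantile F p < ereal (rquantile F p + d)"
    using quantile_eq_ereal[OF F p] \<open>d > 0\<close> by (metis less_add_same_cancel1 less_ereal.simps(1))
  then have "\<forall>\<^sub>F u in at p. quantile F u < ereal (rquantile F p + d)"
    using assms(1) by (intro order_tendstoD(2)) (auto simp: isCont_def)
  then have "\<forall>\<^sub>F u in at_right p. quantile F u < ereal (rquantile F p + d)"
    by (simp add: eventually_at_split)
  moreover have "\<forall>\<^sub>F u in at_right p. u \<in> {p<..<1}"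
    using p by (intro eventually_at_right_real)
  ultimately have "\<forall>\<^sub>F u in at_right p. quantile F u < ereal (rquantile F p + d) \<and> u \<in> {p<..<1}"
    by eventually_elim auto
  from eventually_happens'[OF trivial_limit_at_right_real this]
  obtain u where u: "quantile F u < ereal (rquantile F p + d)" "p < u" "u < 1"
    by auto
  then have "rquantile F u \<le> rquantile F p + d"
    using p quantile_eq_ereal[OF F, of u] by (metis less_ereal.simps(1) less_imp_le order_less_trans)
  then show ?thesis
    using u p rquantile_le_iff[OF F, of u] by auto
qed

text \<open>With \<open>q\<close> the population quantile, \<open>F (q - d) < p < F (q + d)\<close>:
  the left inequality is the Galois connection, the right one needs continuity. A quantile error
  above \<open>d\<close> puts the empirical cdf at \<open>q - d\<close> or \<open>q + d\<close> on
  the wrong side of \<open>p\<close>, hence at least a fixed distance from \<open>F\<close>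
  there.\<close>

lemma empirical_quantile_consistent:
  assumes cont: "isCont (quantile F) p" and "d > 0"
  shows "(\<lambda>n. prob {\<omega>\<in>space M. d < \<bar>empirical_quantile n \<omega> - rquantile F p\<bar>}) \<longlonglongrightarrow> 0"
proof -
  define q where "q = rquantile F p"
  define dev where "dev \<eta> x n = {\<omega>\<in>space M. \<eta> \<le> \<bar>empirical_cdf X n \<omega> x - F x\<bar>}" for \<eta> x n
  have dev: "(\<lambda>n. prob (dev \<eta> x n)) \<longlonglongrightarrow> 0" if "\<eta> > 0" for \<eta> x
    using prob_sample_avg_deviation_tendsto_0[OF _ integrable_indicator_X_sq that, of x]
    by (simp add: dev_def expectation_indicator_X empirical_cdf_eq_sample_avg del: One_nat_def)
  have r: "0 < F (q + d) - p"
    using less_F_right_of_quantile[OF cont \<open>d > 0\<close>] by (simp add: q_def)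
  have l: "0 < p - F (q - d)"
    using rquantile_le_iff[OF right_continuous_mono_F p, of "q - d"] \<open>d > 0\<close> by (simp add: q_def)
  show ?thesis
    unfolding q_def[symmetric]
  proof (rule measure_tendsto_0I)
    show "(\<lambda>n. prob (dev (F (q + d) - p) (q + d) n) + prob (dev (p - F (q - d)) (q - d) n)) \<longlonglongrightarrow> 0"
      using tendsto_add[OF dev[OF r] dev[OF l]] by simp
    fix n :: nat assume n: "n \<ge> 1"
    have sub: "{\<omega>\<in>space M. d < \<bar>empirical_quantile n \<omega> - q\<bar>} \<subseteq>
        dev (F (q + d) - p) (q + d) n \<union> dev (p - F (q - d)) (q - d) n"
    proof
      fix \<omega> assume "\<omega> \<in> {\<omega>\<in>space M. d < \<bar>empirical_quantile n \<omega> - q\<bar>}"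
      then have "\<omega> \<in> space M" and "\<not> empirical_quantile n \<omega> \<le> q + d \<or> empirical_quantile n \<omega> \<le> q - d"
        by auto
      then show "\<omega> \<in> dev (F (q + d) - p) (q + d) n \<union> dev (p - F (q - d)) (q - d) n"
        unfolding empirical_quantile_le_iff[OF n] by (auto simp: dev_def)
    qed
    have ev: "dev \<eta> x n \<in> events" for \<eta> x
      unfolding dev_def by measurable
    show "prob {\<omega>\<in>space M. d < \<bar>empirical_quantile n \<omega> - q\<bar>} \<le>
        prob (dev (F (q + d) - p) (q + d) n) + prob (dev (p - F (q - d)) (q - d) n)"
      by (rule order_trans[OF finite_measure_mono[OF sub] measure_Un_le]) (use ev in auto)
  qed
qed

text \<open>The subtracted term is the closed form of \<open>integral_quantile\<close> for the
  empirical cdf, evaluated at the population quantile instead of the empirical one. It is an average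
  of functions of single observations.\<close>

definition empirical_remainder :: "nat \<Rightarrow> 'a \<Rightarrow> real" where
  "empirical_remainder n \<omega> = (LBINT u:{0..p}. rquantile (empirical_cdf X n \<omega>) u)
     - (p * rquantile F p - sample_avg X (\<lambda>y. max 0 (rquantile F p - y)) n \<omega>)"

lemma empirical_remainder_measurable:
  "n \<ge> 1 \<Longrightarrow> empirical_remainder n \<in> borel_measurable M"
  unfolding empirical_remainder_def
  by (intro borel_measurable_diff integral_empirical_quantile_measurable sample_avg_measurable) auto

lemma abs_empirical_remainder_le:
  assumes n: "n \<ge> 1" and "\<bar>empirical_quantile n \<omega> - rquantile F p\<bar> \<le> d"
  shows "\<bar>empirical_remainder n \<omega>\<bar> \<le>
    (LBINT x:{rquantile F p - d..rquantile F p + d}. \<bar>empirical_cdf X n \<omega> x - F x\<bar>)"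
proof -
  from rquantile_remainder[OF right_continuous_mono_empirical_cdf[OF n] right_continuous_mono_F p assms(2)
      set_integrable_empirical_cdf]
 
  show ?thesis
    by (simp add: empirical_remainder_def integral_empirical_quantile[OF n] integral_empirical_cdf)
qed

text \<open>Either the empirical quantile misses the \<open>d\<close>-neighbourhood, which has
  vanishing probability for fixed \<open>d\<close>, or the scaled integral over that neighbourhood
  is large, which has probability at most \<open>2 * d / \<eta>\<close> for every
  \<open>n \<ge> 1\<close>. So \<open>d\<close> is fixed first and \<open>n\<close> grows
  afterwards.\<close>

lemma empirical_remainder_negligible:
  assumes cont: "isCont (quantile F) p" and "\<eta> > 0"
  shows "(\<lambda>n. prob {\<omega>\<in>space M. \<eta> \<le> sqrt (real n) * \<bar>empirical_remainder n \<omega>\<bar>}) \<longlonglongrightarrow> 0"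
proof (rule LIMSEQ_I)
  fix e :: real assume "e > 0"
  define q where "q = rquantile F p"
  \<comment> \<open>The interval has length \<open>2 * d\<close>, so the Markov bound becomes
    \<open>e / 2\<close>.\<close>
  define d where "d = \<eta> * e / 4"
  have "d > 0" using \<open>e > 0\<close> \<open>\<eta> > 0\<close> by (simp add: d_def)
  define A where "A n = {\<omega>\<in>space M. d < \<bar>empirical_quantile n \<omega> - q\<bar>}" for n
  define B where "B n = {\<omega>\<in>space M. \<eta> \<le> sqrt (real n) *
     (LBINT x:{q - d..q + d}. \<bar>empirical_cdf X n \<omega> x - F x\<bar>)}" for n
  have le: "prob {\<omega>\<in>space M. \<eta> \<le> sqrt (real n) * \<bar>empirical_remainder n \<omega>\<bar>} \<le> prob (A n) + e / 2"
    if n: "n \<ge> 1" for n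
  proof -
    note [measurable] = empirical_quantile_measurable[OF n]
      integral_cdf_deviation_measurable[of "q - d" "q + d" n]
    have A: "A n \<in> events" unfolding A_def by measurable
    have B: "B n \<in> events" unfolding B_def using \<open>d > 0\<close> by measurable
    have sub: "{\<omega>\<in>space M. \<eta> \<le> sqrt (real n) * \<bar>empirical_remainder n \<omega>\<bar>} \<subseteq> A n \<union> B n"
    proof
      fix \<omega> assume \<omega>: "\<omega> \<in> {\<omega>\<in>space M. \<eta> \<le> sqrt (real n) * \<bar>empirical_remainder n \<omega>\<bar>}"
      show "\<omega> \<in> A n \<union> B n"
      proof (cases "\<omega> \<in> A n")
        case False
        with \<omega> have "\<bar>empirical_remainder n \<omega>\<bar> \<le>
            (LBINT x:{q - d..q + d}. \<bar>empirical_cdf X n \<omega> x - F x\<bar>)"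
          unfolding q_def by (intro abs_empirical_remainder_le[OF n]) (auto simp: A_def q_def)
        then have "sqrt (real n) * \<bar>empirical_remainder n \<omega>\<bar> \<le> sqrt (real n) *
            (LBINT x:{q - d..q + d}. \<bar>empirical_cdf X n \<omega> x - F x\<bar>)"
          by (intro mult_left_mono) auto
        with \<omega> show ?thesis by (auto simp: B_def)
      qed auto
    qed
    have "prob (B n) \<le> (q + d - (q - d)) / \<eta>"
      unfolding B_def using \<open>d > 0\<close> \<open>\<eta> > 0\<close>
      by (intro prob_integral_empirical_cdf_deviation[OF n]) auto
    also have "\<dots> = e / 2" using \<open>\<eta> > 0\<close> by (simp add: d_def)
    finally have "prob (B n) \<le> e / 2" .
    moreover have "prob {\<omega>\<in>space M. \<eta> \<le> sqrt (real n) * \<bar>empirical_remainder n \<omega>\<bar>} \<le> prob (A n) + prob (B n)"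
      by (rule order_trans[OF finite_measure_mono[OF sub] measure_Un_le]) (use A B in auto)
    ultimately show ?thesis by linarith
  qed
  obtain N where N: "\<And>n. n \<ge> N \<Longrightarrow> prob (A n) < e / 2"
    using order_tendstoD(2)[OF empirical_quantile_consistent[OF cont \<open>d > 0\<close>], of "e / 2"] \<open>e > 0\<close>
    by (auto simp: eventually_sequentially A_def q_def)
  show "\<exists>N. \<forall>n\<ge>N. norm (prob {\<omega>\<in>space M. \<eta> \<le> sqrt (real n) * \<bar>empirical_remainder n \<omega>\<bar>} - 0) < e"
  proof (intro exI allI impI)
    fix n assume "n \<ge> max 1 N"
    then have "prob {\<omega>\<in>space M. \<eta> \<le> sqrt (real n) * \<bar>empirical_remainder n \<omega>\<bar>} < e / 2 + e / 2"
      using le[of n] N[of n] by fastforce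
    then show "norm (prob {\<omega>\<in>space M. \<eta> \<le> sqrt (real n) * \<bar>empirical_remainder n \<omega>\<bar>} - 0) < e" by simp
  qed
qed

end

end

section \<open>Linearization\<close>

text \<open>With \<open>u = s - m\<close> and \<open>v = x - \<mu>\<close> the error equals
  \<open>r / x + (u * v + A / \<mu> * v\<^sup>2) / (\<mu> * x)\<close> exactly: the first-order
  terms cancel. The hypothesis \<open>near\<close> keeps \<open>\<bar>x\<bar>\<close> above
  \<open>\<bar>\<mu>\<bar> / 2\<close>.\<close>

lemma ratio_linearization_error:
  fixes A r s m x \<mu> :: real
  assumes "\<mu> \<noteq> 0" and near: "\<bar>x - \<mu>\<bar> \<le> \<bar>\<mu>\<bar> / 2"
  shows "\<bar>(A - (s - m) + r) / x - A / \<mu> + ((s - m) / \<mu> + A / \<mu> / \<mu> * (x - \<mu>))\<bar>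
    \<le> 2 / \<bar>\<mu>\<bar> * \<bar>r\<bar> + 2 * (1 + \<bar>A / \<mu>\<bar>) / \<mu>\<^sup>2 * ((s - m)\<^sup>2 + (x - \<mu>)\<^sup>2)"
proof -
  define u v where "u = s - m" and "v = x - \<mu>"
  have x: "\<bar>\<mu>\<bar> / 2 \<le> \<bar>x\<bar>" "x \<noteq> 0" using assms by linarith+
  have inv: "1 / \<bar>x\<bar> \<le> 2 / \<bar>\<mu>\<bar>"
    using x \<open>\<mu> \<noteq> 0\<close> by (simp add: field_simps)
  have uv: "\<bar>u * v\<bar> \<le> u\<^sup>2 + v\<^sup>2"
  proof -
    have "2 * \<bar>u * v\<bar> \<le> u\<^sup>2 + v\<^sup>2"
      using sum_squares_bound[of "\<bar>u\<bar>" "\<bar>v\<bar>"] by (simp add: abs_mult mult.assoc)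
    then show ?thesis using abs_ge_zero[of "u * v"] by linarith
  qed
  have "(A - u + r) / x - A / \<mu> + (u / \<mu> + A / \<mu> / \<mu> * v)
      = r / x + (u * v + A / \<mu> * v\<^sup>2) / (\<mu> * x)"
    using \<open>x \<noteq> 0\<close> \<open>\<mu> \<noteq> 0\<close> unfolding v_def by (simp add: field_simps power2_eq_square)
  also have "\<bar>\<dots>\<bar> \<le> \<bar>r / x\<bar> + \<bar>(u * v + A / \<mu> * v\<^sup>2) / (\<mu> * x)\<bar>"
    by (rule abs_triangle_ineq)
  also have "\<bar>r / x\<bar> \<le> 2 / \<bar>\<mu>\<bar> * \<bar>r\<bar>"
    using mult_right_mono[OF inv abs_ge_zero[of r]] by (simp add: abs_divide)
  also have "\<bar>(u * v + A / \<mu> * v\<^sup>2) / (\<mu> * x)\<bar> \<le> (1 + \<bar>A / \<mu>\<bar>) * (u\<^sup>2 + v\<^sup>2) * (2 / \<mu>\<^sup>2)"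
  proof -
    have "\<bar>u * v + A / \<mu> * v\<^sup>2\<bar> \<le> \<bar>u * v\<bar> + \<bar>A / \<mu>\<bar> * v\<^sup>2"
      by (metis abs_mult abs_power2 abs_triangle_ineq)
    also have "\<dots> \<le> (u\<^sup>2 + v\<^sup>2) + \<bar>A / \<mu>\<bar> * (u\<^sup>2 + v\<^sup>2)"
      by (intro add_mono uv mult_left_mono) auto
    finally have 1: "\<bar>u * v + A / \<mu> * v\<^sup>2\<bar> \<le> (1 + \<bar>A / \<mu>\<bar>) * (u\<^sup>2 + v\<^sup>2)"
      by (simp add: algebra_simps)
    have 2: "1 / \<bar>\<mu> * x\<bar> \<le> 2 / \<mu>\<^sup>2"
      using divide_right_mono[OF inv, of "\<bar>\<mu>\<bar>"]
      by (simp add: abs_mult power2_eq_square mult.commute)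
    show ?thesis
      using mult_mono[OF 1 2] by (simp add: abs_divide)
  qed
  also have "(1 + \<bar>A / \<mu>\<bar>) * (u\<^sup>2 + v\<^sup>2) * (2 / \<mu>\<^sup>2) =
      2 * (1 + \<bar>A / \<mu>\<bar>) / \<mu>\<^sup>2 * (u\<^sup>2 + v\<^sup>2)"
    by (simp only: times_divide_eq_left times_divide_eq_right mult_ac)
  finally show ?thesis by (simp add: u_def v_def)
qed

section \<open>The asymptotic expansion\<close>

context iid_sample
begin

text \<open>A finite first moment makes the integrals of the indicator and of \<open>F\<close>
  finite separately. The influence function thus becomes a combination of the centred
  \<open>max 0 (q - y)\<close> and the centred \<open>y\<close>, ready for sample averages.\<close>

lemma lorenz_influence_eq:
  assumes "integrable M (X 1)"
  shows "lorenz_influence \<mu> F p y =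
    1 / \<mu> * (max 0 (rquantile F p - y) - expectation (\<lambda>\<omega>. max 0 (rquantile F p - X 1 \<omega>)))
    + lorenz \<mu> F p / \<mu> * (y - \<mu>)"
  using has_bochner_integral_diff[OF has_bochner_integral_indicator_atMost[of "rquantile F p" y]
      has_bochner_integral_F[OF assms, of "rquantile F p"]]
  unfolding lorenz_influence_def set_lebesgue_integral_def
  by (simp add: has_bochner_integral_iff scaleR_diff_right right_diff_distrib)

lemma lorenz_eq:
  assumes "integrable M (X 1)" and p: "0 < p" "p < 1"
  shows "lorenz \<mu> F p =
    1 / \<mu> * (p * rquantile F p - expectation (\<lambda>\<omega>. max 0 (rquantile F p - X 1 \<omega>)))"
proof -
  have int: "set_integrable lborel {..t} F"
    and eq: "(LBINT x:{..t}. F x) = expectation (\<lambda>\<omega>. max 0 (t - X 1 \<omega>))" for t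
    using has_bochner_integral_F[OF assms(1), of t]
    by (simp_all add: set_integrable_def set_lebesgue_integral_def has_bochner_integral_iff)
  show ?thesis
    unfolding lorenz_def integral_quantile[OF right_continuous_mono_F p int] eq ..
qed

text \<open>Outside three events the error is bounded deterministically by
  \<open>ratio_linearization_error\<close>. The events are a sample mean far from
  \<open>\<mu>\<close> (\<open>B1\<close>), a large scaled remainder (\<open>B2\<close>) and large
  scaled squared deviations (\<open>B3\<close>); the last has probability of order
  \<open>1 / sqrt n\<close> by Markov's inequality.\<close>

lemma lorenz_linearization_negligible:
  assumes sq: "integrable M (\<lambda>\<omega>. (X 1 \<omega>)\<^sup>2)" and mean: "\<mu> = expectation (X 1)" and "\<mu> \<noteq> 0"
    and p: "0 < p" "p < 1" and cont: "isCont (quantile F) p"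
  shows "converges_to_zero_in_prob M
    (\<lambda>n \<omega>. sqrt (real n) * (empirical_lorenz X n p \<omega> - lorenz \<mu> F p)
          - (- (1 / sqrt (real n)) * (\<Sum>i=1..n. lorenz_influence \<mu> F p (X i \<omega>))))"
    (is "converges_to_zero_in_prob M ?T")
proof -
  have X1 [measurable]: "X 1 \<in> borel_measurable M" by (rule measurable_X) simp
  have int: "integrable M (X 1)"
    by (rule square_integrable_imp_integrable[OF _ sq]) measurable
  define q where "q = rquantile F p"
  define g where "g y = max 0 (q - y)" for y :: real
  define m where "m = expectation (\<lambda>\<omega>. g (X 1 \<omega>))"
  define A where "A = p * q - m"
  have g_meas [measurable]: "g \<in> borel_measurable borel"
    unfolding g_def by measurable
  have g_sq: "integrable M (\<lambda>\<omega>. (g (X 1 \<omega>))\<^sup>2)"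
  proof (rule Bochner_Integration.integrable_bound)
    show "integrable M (\<lambda>\<omega>. (q - X 1 \<omega>)\<^sup>2)"
      using sq int by (simp add: power2_diff)
    show "AE \<omega> in M. norm ((g (X 1 \<omega>))\<^sup>2) \<le> norm ((q - X 1 \<omega>)\<^sup>2)"
      by (auto simp: g_def max_def)
  qed measurable
  define S where "S n \<omega> = sample_avg X g n \<omega> - m" for n \<omega>
  define V where "V n \<omega> = sample_mean X n \<omega> - \<mu>" for n \<omega>
  define r where "r = empirical_remainder p"
  have mean_eq: "sample_mean X n \<omega> = sample_avg X (\<lambda>y. y) n \<omega>" for n \<omega>
    by (simp add: sample_mean_def sample_avg_def)
  have S_meas [measurable]: "S n \<in> borel_measurable M" and V_meas [measurable]: "V n \<in> borel_measurable M" for n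
    unfolding S_def V_def mean_eq by measurable
  have L: "lorenz \<mu> F p = A / \<mu>"
    by (simp add: lorenz_eq[OF int p] A_def m_def g_def q_def)
  have infl: "lorenz_influence \<mu> F p y = (g y - m) / \<mu> + A / \<mu> / \<mu> * (y - \<mu>)" for y
    by (simp add: lorenz_influence_eq[OF int] L m_def g_def q_def)
  \<comment> \<open>Exact for all \<open>n\<close> and \<open>\<omega>\<close>: the numerator
    telescopes to the empirical quantile integral, and for a vanishing sample mean both sides are
    0.\<close>
  have EL: "empirical_lorenz X n p \<omega> = (A - S n \<omega> + r n \<omega>) / sample_mean X n \<omega>" for n \<omega>
    by (simp add: empirical_lorenz_def lorenz_def r_def empirical_remainder_def[OF p] A_def S_def
        g_def[abs_def] q_def)
  have T_eq: "?T n \<omega> = sqrt (real n) * ((A - S n \<omega> + r n \<omega>) / sample_mean X n \<omega> - A / \<mu>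
      + (S n \<omega> / \<mu> + A / \<mu> / \<mu> * V n \<omega>))" if n: "n \<ge> 1" for n \<omega>
  proof -
    have nS: "real n * S n \<omega> = (\<Sum>i=1..n. g (X i \<omega>) - m)"
      and nV: "real n * V n \<omega> = (\<Sum>i=1..n. X i \<omega> - \<mu>)"
      using n by (simp_all add: S_def V_def sample_avg_def sample_mean_def sum_subtractf right_diff_distrib)
    have "(\<Sum>i=1..n. lorenz_influence \<mu> F p (X i \<omega>)) =
        real n * S n \<omega> / \<mu> + A / \<mu> / \<mu> * (real n * V n \<omega>)"
      unfolding infl nS nV sum.distrib sum_divide_distrib sum_distrib_left ..
    also have "\<dots> = real n * (S n \<omega> / \<mu> + A / \<mu> / \<mu> * V n \<omega>)"
      by (simp add: algebra_simps)
    finally have sum: "(\<Sum>i=1..n. lorenz_influence \<mu> F p (X i \<omega>)) =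
        real n * (S n \<omega> / \<mu> + A / \<mu> / \<mu> * V n \<omega>)" .
    have "1 / sqrt (real n) * real n = sqrt (real n)"
      using n by (simp add: real_div_sqrt)
    then have "1 / sqrt (real n) * (\<Sum>i=1..n. lorenz_influence \<mu> F p (X i \<omega>)) =
        sqrt (real n) * (S n \<omega> / \<mu> + A / \<mu> / \<mu> * V n \<omega>)"
      unfolding sum mult.assoc[symmetric] by (rule arg_cong)
    then show ?thesis by (simp add: EL L algebra_simps)
  qed
  have T_meas: "?T n \<in> borel_measurable M" for n
  \<comment> \<open>For \<open>n = 0\<close> the factor \<open>sqrt 0\<close> and the empty sum make
    the expression identically 0.\<close>
  proof (cases "n = 0")
    case False
    then have n: "n \<ge> 1" by simp
    have [measurable]: "r n \<in> borel_measurable M"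
      unfolding r_def by (rule empirical_remainder_measurable[OF p n])
    have [measurable]: "sample_mean X n \<in> borel_measurable M"
      unfolding mean_eq[abs_def] by measurable
    show ?thesis unfolding T_eq[OF n] by measurable
  qed auto
  define K where "K = 2 * (1 + \<bar>A / \<mu>\<bar>) / \<mu>\<^sup>2"
  have "K > 0"
    unfolding K_def using \<open>\<mu> \<noteq> 0\<close>
    by (intro divide_pos_pos mult_pos_pos add_pos_nonneg abs_ge_zero) simp_all
  define C where "C = expectation (\<lambda>\<omega>. (g (X 1 \<omega>))\<^sup>2) + expectation (\<lambda>\<omega>. (X 1 \<omega>)\<^sup>2)"
  have SV_int: "integrable M (\<lambda>\<omega>. (S n \<omega>)\<^sup>2 + (V n \<omega>)\<^sup>2)"
    and SV_le: "expectation (\<lambda>\<omega>. (S n \<omega>)\<^sup>2 + (V n \<omega>)\<^sup>2) \<le> C / real n" if n: "n \<ge> 1" for n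
    using integrable_sample_avg_sq[OF g_meas g_sq n] expectation_sample_avg_sq[OF g_meas g_sq n]
      integrable_sample_avg_sq[of "\<lambda>y. y" n] expectation_sample_avg_sq[of "\<lambda>y. y" n] sq n
    by (simp_all add: S_def V_def m_def mean mean_eq C_def add_divide_distrib del: One_nat_def)
  have SV: "prob {\<omega>\<in>space M. \<eta> \<le> sqrt (real n) * ((S n \<omega>)\<^sup>2 + (V n \<omega>)\<^sup>2)} \<le> C / sqrt (real n) / \<eta>"
    if n: "n \<ge> 1" and "\<eta> > 0" for n \<eta>
  proof -
    have "prob {\<omega>\<in>space M. \<eta> \<le> sqrt (real n) * ((S n \<omega>)\<^sup>2 + (V n \<omega>)\<^sup>2)} \<le>
        expectation (\<lambda>\<omega>. sqrt (real n) * ((S n \<omega>)\<^sup>2 + (V n \<omega>)\<^sup>2)) / \<eta>"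
      by (rule integral_Markov_inequality_measure[of _ _ "space M"])
         (use SV_int[OF n] \<open>\<eta> > 0\<close> in auto)
    also have "\<dots> \<le> sqrt (real n) * (C / real n) / \<eta>"
      unfolding Bochner_Integration.integral_mult_right_zero using \<open>\<eta> > 0\<close>
      by (intro divide_right_mono mult_left_mono SV_le[OF n]) auto
    also have "sqrt (real n) * (C / real n) = C * (sqrt (real n) / real n)"
      by simp
    also have "\<dots> = C / sqrt (real n)"
    proof -
      have "sqrt (real n) / real n = 1 / sqrt (real n)"
        using n by (simp add: field_simps)
      then show ?thesis by simp
    qed
    finally show ?thesis .
  qed
  show ?thesis
    unfolding converges_to_zero_in_prob_def
  proof (intro conjI allI impI T_meas)
    fix \<epsilon> :: real assume "\<epsilon> > 0"
    \<comment> \<open>\<open>\<eta>\<close> and \<open>\<theta>\<close> are scaled so that the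
      remainder and the quadratic part contribute \<open>\<epsilon> / 2\<close> each.\<close>
    define \<eta> where "\<eta> = \<epsilon> * \<bar>\<mu>\<bar> / 4"
    define \<theta> where "\<theta> = \<epsilon> / (2 * K)"
    have pos: "\<eta> > 0" "\<theta> > 0" "\<bar>\<mu>\<bar> / 2 > 0"
      using \<open>\<epsilon> > 0\<close> \<open>\<mu> \<noteq> 0\<close> \<open>K > 0\<close> by (auto simp: \<eta>_def \<theta>_def)
    define B1 where "B1 n = {\<omega>\<in>space M. \<bar>\<mu>\<bar> / 2 \<le> \<bar>V n \<omega>\<bar>}" for n
    define B2 where "B2 n = {\<omega>\<in>space M. \<eta> \<le> sqrt (real n) * \<bar>r n \<omega>\<bar>}" for n
    define B3 where "B3 n = {\<omega>\<in>space M. \<theta> \<le> sqrt (real n) * ((S n \<omega>)\<^sup>2 + (V n \<omega>)\<^sup>2)}" for n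
    show "(\<lambda>n. prob {\<omega>\<in>space M. \<bar>?T n \<omega>\<bar> > \<epsilon>}) \<longlonglongrightarrow> 0"
    proof (rule measure_tendsto_0I)
      fix n :: nat assume n: "n \<ge> 1"
      have [measurable]: "r n \<in> borel_measurable M"
        unfolding r_def by (rule empirical_remainder_measurable[OF p n])
      have ev: "B1 n \<in> events" "B2 n \<in> events" "B3 n \<in> events"
        unfolding B1_def B2_def B3_def by measurable
      have sub: "{\<omega>\<in>space M. \<bar>?T n \<omega>\<bar> > \<epsilon>} \<subseteq> (B1 n \<union> B2 n) \<union> B3 n"
      proof (rule ccontr)
        assume "\<not> ?thesis"
        then obtain \<omega> where \<omega>: "\<omega> \<in> space M" "\<bar>?T n \<omega>\<bar> > \<epsilon>" "\<omega> \<notin> B1 n" "\<omega> \<notin> B2 n" "\<omega> \<notin> B3 n"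
          by auto
        then have near: "\<bar>sample_mean X n \<omega> - \<mu>\<bar> \<le> \<bar>\<mu>\<bar> / 2"
          by (simp add: B1_def V_def)
        have "\<bar>?T n \<omega>\<bar> \<le> sqrt (real n) * (2 / \<bar>\<mu>\<bar> * \<bar>r n \<omega>\<bar> + K * ((S n \<omega>)\<^sup>2 + (V n \<omega>)\<^sup>2))"
          unfolding T_eq[OF n] abs_mult K_def S_def V_def
          using ratio_linearization_error[OF \<open>\<mu> \<noteq> 0\<close> near]
          by (simp add: mult_left_mono)
        also have "\<dots> = 2 / \<bar>\<mu>\<bar> * (sqrt (real n) * \<bar>r n \<omega>\<bar>)
            + K * (sqrt (real n) * ((S n \<omega>)\<^sup>2 + (V n \<omega>)\<^sup>2))"
          by (simp add: algebra_simps)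
        also have "\<dots> \<le> 2 / \<bar>\<mu>\<bar> * \<eta> + K * \<theta>"
          using \<omega> \<open>K > 0\<close> by (intro add_mono mult_left_mono) (auto simp: B2_def B3_def)
        also have "\<dots> = \<epsilon>"
          using \<open>\<mu> \<noteq> 0\<close> \<open>K > 0\<close> by (simp add: \<eta>_def \<theta>_def field_simps)
        finally show False using \<omega> by simp
      qed
      have "prob {\<omega>\<in>space M. \<bar>?T n \<omega>\<bar> > \<epsilon>} \<le> prob (B1 n \<union> B2 n \<union> B3 n)"
        by (rule finite_measure_mono[OF sub]) (use ev in auto)
      also have "\<dots> \<le> prob (B1 n) + prob (B2 n) + prob (B3 n)"
        using ev by (intro order_trans[OF measure_Un_le] add_right_mono measure_Un_le) auto
      also have "prob (B3 n) \<le> C / sqrt (real n) / \<theta>"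
        unfolding B3_def by (rule SV[OF n pos(2)])
      finally show "prob {\<omega>\<in>space M. \<bar>?T n \<omega>\<bar> > \<epsilon>} \<le> prob (B1 n) + prob (B2 n) + C / sqrt (real n) / \<theta>"
        by simp
    next
      have "(\<lambda>n. prob (B1 n)) \<longlonglongrightarrow> 0"
        using prob_sample_avg_deviation_tendsto_0[of "\<lambda>y. y", OF _ sq pos(3)]
        by (simp add: B1_def V_def mean_eq mean)
      moreover have "(\<lambda>n. prob (B2 n)) \<longlonglongrightarrow> 0"
        unfolding B2_def r_def by (rule empirical_remainder_negligible[OF p cont pos(1)])
      moreover have "(\<lambda>n. C / sqrt (real n) / \<theta>) \<longlonglongrightarrow> 0"
        by (intro tendsto_divide_zero tendsto_divide_0[OF tendsto_const]
            filterlim_compose[OF filterlim_at_top_imp_at_infinity]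
            filterlim_compose[OF sqrt_at_top filterlim_real_sequentially] filterlim_at_top_imp_at_infinity)
      ultimately show "(\<lambda>n. prob (B1 n) + prob (B2 n) + C / sqrt (real n) / \<theta>) \<longlonglongrightarrow> 0"
        by (auto intro!: tendsto_add_zero)
    qed
  qed
qed

end

theorem lemmaA3:
  fixes M :: "'a measure" and X :: "nat \<Rightarrow> 'a \<Rightarrow> real" and F :: "real \<Rightarrow> real" and \<mu> p :: real
  assumes "prob_space M"
    and "prob_space.indep_vars M (\<lambda>_. borel) X {1..}"
    and "\<And>i. i \<ge> 1 \<Longrightarrow> cdf (distr M borel (X i)) = F"
    and "integrable M (\<lambda>\<omega>. (X 1 \<omega>)\<^sup>2)"
    and "\<mu> = integral\<^sup>L M (X 1)"
    and "\<mu> \<noteq> 0"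
    and "0 < p" and "p < 1"
    and "isCont (quantile F) p"
  shows "converges_to_zero_in_prob M
    (\<lambda>n \<omega>. sqrt (real n) * (empirical_lorenz X n p \<omega> - lorenz \<mu> F p)
          - (- (1 / sqrt (real n)) * (\<Sum>i=1..n. lorenz_influence \<mu> F p (X i \<omega>))))"
proof -
  interpret iid_sample M X F
    by (intro iid_sample.intro iid_sample_axioms.intro assms)
  show ?thesis
    by (rule lorenz_linearization_negligible) (fact assms)+
qed

end
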